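(* Let $\upsilon\ge1$ be an integer, $q>-1$ and $p$ real, $s\ge0$ an integer with $s<\frac{p-1}{2}$, let $y_1\neq0$ and $y_2$ be real numbers, and let $a,b$ be complex numbers with $\operatorname{Re}(a)>0$, $\operatorname{Re}(b)>0$. Then the two-dimensional Laplace transform in $(t,w)$, evaluated at $(a,b)$, satisfies $$\mathcal L_2\left\{t^{p-s-1}w^q\;{}_KN_{s;\upsilon}^{(p,q)}\!\left(\frac1{y_1t},\,y_2w\right)\right\}(a,b)=\frac{\Gamma(p-s)}{a^{p-s}\,b^{q+1}}\left(\frac{a}{y_1}\left(1-\frac{y_2^{\upsilon}}{b^{\upsilon}}\right)-1\right)^{s}.$$
   Context: $(a)_n$ is the Pochhammer symbol. The first set of finite bivariate biorthogonal N-Konhauser polynomials is $${}_KN_{s;\upsilon}^{(p,q)}(t,w)=\Gamma(p-s)\sum_{k=0}^{s}\sum_{m=0}^{s-k}\frac{(-s)_{k+m}\,t^{s-k}w^{\upsilon m}}{\Gamma(p-2s+k)\,\Gamma(q+1+\upsilon m)\,k!\,m!}.$$ The 2D Laplace transform is $\mathcal L_2\{f\}(a,b)=\int_0^\infty\int_0^\infty e^{-(at+bw)}f(t,w)\,dt\,dw$. Complex powers $a^{p-s}$, $b^{q+1}$ are principal. *)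

theory Defs
  imports "HOL-Analysis.Analysis"
begin

definition N_Konhauser :: "nat \<Rightarrow> nat \<Rightarrow> real \<Rightarrow> real \<Rightarrow> real \<Rightarrow> real \<Rightarrow> real" where
  "N_Konhauser s \<upsilon> p q t w =
     Gamma (p - real s) *
     (\<Sum>k=0..s. \<Sum>m=0..s - k.
        pochhammer (- real s) (k + m) * t ^ (s - k) * w ^ (\<upsilon> * m) /
        (Gamma (p - 2 * real s + real k) * Gamma (q + 1 + real (\<upsilon> * m)) * fact k * fact m))"

definition laplace2_kernel ::
  "(real \<Rightarrow> real \<Rightarrow> complex) \<Rightarrow> complex \<Rightarrow> complex \<Rightarrow> real \<Rightarrow> real \<Rightarrow> complex" where
  "laplace2_kernel f a b t w = exp (- (a * of_real t + b * of_real w)) * f t w"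

(* The Bochner integral of a non-integrable function is 0 by convention, so convergence of the
   double integral is a separate predicate: absolute integrability on the open quadrant. *)
definition laplace2_converges ::
  "(real \<Rightarrow> real \<Rightarrow> complex) \<Rightarrow> complex \<Rightarrow> complex \<Rightarrow> bool" where
  "laplace2_converges f a b \<longleftrightarrow>
     set_integrable lborel ({0<..} \<times> {0<..}) (\<lambda>(t, w). laplace2_kernel f a b t w)"

definition laplace2 ::
  "(real \<Rightarrow> real \<Rightarrow> complex) \<Rightarrow> complex \<Rightarrow> complex \<Rightarrow> complex" where
  "laplace2 f a b =
     set_lebesgue_integral lborel {0<..} (\<lambda>w.
       set_lebesgue_integral lborel {0<..} (\<lambda>t. laplace2_kernel f a b t w))"

end

theory Submission
  imports Defs
begin

text \<open>
  The function to be transformed is a finite sum of separated terms: in the summand with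
  indices \<open>k\<close>, \<open>m\<close>, the power \<open>(1 / (y1 * t)) ^ (s - k)\<close> merges with the weight to give a
  multiple of \<open>t powr (p - 2 * s + k - 1)\<close>, and the \<open>w\<close>-part is a multiple of
  \<open>w powr (q + \<upsilon> * m)\<close>. The hypotheses on \<open>p\<close>, \<open>q\<close> and \<open>s\<close> put all these exponents
  above \<open>-1\<close>, so each one-dimensional transform converges absolutely and equals
  \<open>Gamma r / z powr r\<close> (\<open>has_laplace_powr\<close>); Fubini then handles the finite sum
  (\<open>laplace2_sum_of_products\<close>). The two Gamma factors produced by the transforms cancel those in
  the denominators of the polynomial. With \<open>A = a / y1\<close> and \<open>X = (y2 / b) ^ \<upsilon>\<close>, there remains
  the sum of \<open>pochhammer (- s) (k + m) / (k! m!) * A ^ (s - k) * X ^ m\<close>, which is the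
  trinomial expansion of \<open>(A - A * X - 1) ^ s\<close> (\<open>trinomial_pochhammer_sum\<close>).

  The analytic content is the Gamma integral at a complex parameter \<open>z\<close> with positive real
  part. Instead of rotating a contour, one expands around a real point: if \<open>x\<close> is real and large
  enough, then \<open>z = x + h\<close> with \<open>norm h < x\<close>. Integrating the exponential series of
  \<open>exp (- h * t)\<close> against \<open>t powr (r - 1) * exp (- x * t)\<close> term by term gives the binomial
  series of \<open>(1 + h / x) powr (- r)\<close>, which converges because \<open>norm h < x\<close>.
\<close>

section \<open>The Laplace transform of a power\<close>

text \<open>
  The integrability is part of the predicate, so that existence and value of a transform travel
  together and can both be handed to Fubini.
\<close>
definition has_laplace :: "(real \<Rightarrow> complex) \<Rightarrow> complex \<Rightarrow> complex \<Rightarrow> bool" where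
  "has_laplace g z L \<longleftrightarrow>
     has_bochner_integral lborel
       (\<lambda>t. indicator {0<..} t *\<^sub>R (exp (- (z * of_real t)) * g t)) L"

lemma has_laplace_mult_left:
  "has_laplace g z L \<Longrightarrow> has_laplace (\<lambda>t. c * g t) z (c * L)"
  unfolding has_laplace_def
  using has_bochner_integral_mult_right[of c lborel
      "\<lambda>t. indicator {0<..} t *\<^sub>R (exp (- (z * of_real t)) * g t)" L]
  by (simp add: scaleR_conv_of_real mult_ac)

lemma gamma_integral_scaled:
  fixes r x :: real
  assumes r: "r > 0" and x: "x > 0"
  shows "has_bochner_integral lborel
           (\<lambda>t. indicator {0<..} t * (t powr (r - 1) * exp (- (x * t)))) (Gamma r / x powr r)"
proof -
  let ?f = "\<lambda>t::real. indicator {0<..} t * (t powr (r - 1) * exp (- t)) :: real"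
  have "(\<integral>\<^sup>+t. ennreal (?f t) \<partial>lborel) = ennreal (Gamma r)"
    unfolding Gamma_conv_nn_integral_real[OF r]
    by (intro nn_integral_cong arg_cong[where f = ennreal])
       (auto simp: indicator_def exp_minus field_simps)
  then have "has_bochner_integral lborel ?f (Gamma r)"
    by (intro has_bochner_integral_nn_integral) (auto simp: Gamma_real_pos r less_imp_le)
  then have "has_bochner_integral lborel (\<lambda>t. ?f (0 + x * t)) (Gamma r /\<^sub>R \<bar>x\<bar>)"
    using x by (subst (asm) lborel_has_bochner_integral_real_affine_iff[of x _ _ 0]) auto
  then have "has_bochner_integral lborel (\<lambda>t. x powr (1 - r) * ?f (0 + x * t))
      (x powr (1 - r) * (Gamma r /\<^sub>R \<bar>x\<bar>))"
    by (rule has_bochner_integral_mult_right)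
  also have "(\<lambda>t. x powr (1 - r) * ?f (0 + x * t)) =
      (\<lambda>t. indicator {0<..} t * (t powr (r - 1) * exp (- (x * t))))"
  proof
    fix t
    have "x powr (1 - r) * x powr (r - 1) = 1"
      using x by (simp flip: powr_add)
    then show "x powr (1 - r) * ?f (0 + x * t) =
        indicator {0<..} t * (t powr (r - 1) * exp (- (x * t)))"
      using x by (auto simp: indicator_def zero_less_mult_iff powr_mult)
  qed
  also have "x powr (1 - r) * (Gamma r /\<^sub>R \<bar>x\<bar>) = Gamma r / x powr r"
    using x by (simp add: powr_diff field_simps)
  finally show ?thesis .
qed

text \<open>
  The discs of centre \<open>x > 0\<close> and radius \<open>x\<close> exhaust the right half-plane: membership of \<open>z\<close>
  means \<open>(norm z)\<^sup>2 < 2 * x * Re z\<close>, which holds for all large \<open>x\<close>.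
\<close>
lemma exists_real_dominating_distance:
  fixes z :: complex
  assumes "Re z > 0"
  obtains x :: real where "x > 0" "norm (z - of_real x) < x"
proof -
  define x where "x = (norm z)\<^sup>2 / Re z"
  have n: "(norm z)\<^sup>2 = (Re z)\<^sup>2 + (Im z)\<^sup>2" by (rule cmod_power2)
  have "z \<noteq> 0" using assms by auto
  then have x: "x > 0" and e: "x * Re z = (norm z)\<^sup>2"
    using assms by (auto simp: x_def)
  have "(norm (z - of_real x))\<^sup>2 = (norm z)\<^sup>2 - 2 * (x * Re z) + x\<^sup>2"
    unfolding cmod_power2 by (simp add: power2_eq_square algebra_simps)
  also have "\<dots> < x\<^sup>2" using e \<open>z \<noteq> 0\<close> by simp
  finally have "norm (z - of_real x) < x"
    using x by (simp add: power_less_imp_less_base)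
  with x that show ?thesis by blast
qed

text \<open>
  Term by term integration of the exponential series around a real point \<open>x\<close>. The partial sums
  are dominated by \<open>t powr (r - 1) * exp (- (x - norm h) * t)\<close>, which is again a Gamma integrand
  since \<open>norm h < x\<close>. This one bound gives integrability of the limit and convergence of the
  integrated series, whose sum is then read off from the generalised binomial theorem.
\<close>
theorem has_laplace_powr:
  fixes r :: real and z :: complex
  assumes r: "r > 0" and z: "Re z > 0"
  shows "has_laplace (\<lambda>t. of_real (t powr (r - 1))) z
           (of_real (Gamma r) / z powr of_real r)"
proof -
  obtain x :: real where x: "x > 0" and zx: "norm (z - of_real x) < x"
    using exists_real_dominating_distance[OF z] .
  define h where "h = z - of_real x"
  \<comment> \<open>The factor \<open>t ^ n\<close> of the exponential series is absorbed into the exponent of \<open>t\<close>,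
     so that every summand is itself a real Gamma integrand.\<close>
  define summand where "summand = (\<lambda>(n::nat) (t::real). (- h) ^ n / fact n *
    of_real (indicator {0<..} t * (t powr (r + real n - 1) * exp (- (x * t)))))"
  define val where "val = (\<lambda>n::nat. (- h) ^ n / fact n *
    of_real (Gamma (r + real n) / x powr (r + real n)))"
  let ?lim = "\<lambda>t::real. indicator {0<..} t *\<^sub>R
    (exp (- (z * of_real t)) * complex_of_real (t powr (r - 1)))"
  let ?dom = "\<lambda>t::real. indicator {0<..} t * (t powr (r - 1) * exp (- ((x - norm h) * t))) :: real"
  have summand_integral: "has_bochner_integral lborel (summand n) (val n)" for n
    unfolding summand_def val_def
    by (intro has_bochner_integral_mult_right has_bochner_integral_of_real gamma_integral_scaled)
       (use r x in auto)
  have summand_eq: "summand n t = indicator {0<..} t *\<^sub>R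
      (of_real (t powr (r - 1) * exp (- (x * t))) * ((- (h * of_real t)) ^ n / fact n))" for n t
    by (auto simp: summand_def indicator_def powr_add powr_diff powr_realpow power_mult_distrib
        power_minus[of h] power_minus[of "h * of_real t"] mult_ac)
  have partial_tendsto: "(\<lambda>N. \<Sum>n<N. summand n t) \<longlonglongrightarrow> ?lim t" for t
  proof -
    have "(\<lambda>n. (- (h * of_real t)) ^ n / fact n) sums exp (- (h * of_real t))"
      using exp_converges[of "- (h * of_real t)"]
      by (simp add: scaleR_conv_of_real divide_inverse mult.commute)
    then have "(\<lambda>n. summand n t) sums (indicator {0<..} t *\<^sub>R
        (of_real (t powr (r - 1) * exp (- (x * t))) * exp (- (h * of_real t))))"
      unfolding summand_eq by (intro sums_scaleR_right sums_mult)
    also have "\<dots> = ?lim t"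
    proof -
      have "exp (- (z * of_real t)) = exp (- (of_real x * of_real t)) * exp (- (h * of_real t))"
        by (simp add: h_def algebra_simps flip: exp_add)
      then show ?thesis
        by (simp add: exp_of_real[symmetric] mult_ac)
    qed
    finally show ?thesis by (simp add: sums_def)
  qed
  have partial_bound: "norm (\<Sum>n<N. summand n t) \<le> ?dom t" for N t
  proof (cases "t > 0")
    case t: True
    have "norm (\<Sum>n<N. summand n t) \<le> (\<Sum>n<N. norm (summand n t))"
      by (rule norm_sum)
    also have "\<dots> = t powr (r - 1) * exp (- (x * t)) * (\<Sum>n<N. (norm h * t) ^ n / fact n)"
      using t unfolding summand_eq sum_distrib_left
      by (intro sum.cong) (auto simp: norm_mult norm_divide norm_power)
    also have "\<dots> \<le> t powr (r - 1) * exp (- (x * t)) * exp (norm h * t)"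
    proof (rule mult_left_mono)
      have s: "(\<lambda>n. (norm h * t) ^ n / fact n) sums exp (norm h * t)"
        using exp_converges[of "norm h * t"] by (simp add: divide_inverse mult.commute)
      show "(\<Sum>n<N. (norm h * t) ^ n / fact n) \<le> exp (norm h * t)"
        using t s by (subst sums_unique[OF s], intro sum_le_suminf) (auto simp: sums_iff)
    qed simp
    also have "\<dots> = ?dom t"
      using t by (simp add: algebra_simps flip: exp_add)
    finally show ?thesis .
  next
    case False
    then show ?thesis by (simp add: summand_eq)
  qed
  have dom: "integrable lborel ?dom"
    using gamma_integral_scaled[of r "x - norm h"] r zx
    by (auto simp: h_def has_bochner_integral_iff)
  have meas: "(\<lambda>t. \<Sum>n<N. summand n t) \<in> borel_measurable lborel" for N
    using summand_integral by (intro borel_measurable_sum) (auto dest: borel_measurable_has_bochner_integral)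
  have lim_meas: "?lim \<in> borel_measurable lborel"
    using partial_tendsto by (rule borel_measurable_LIMSEQ_metric[OF meas])
  note dominated = lim_meas meas dom AE_I2[OF partial_tendsto] AE_I2[OF partial_bound]
  have conv: "integrable lborel ?lim"
    by (rule integrable_dominated_convergence[OF dominated])
  have tends: "(\<lambda>N. \<integral>t. (\<Sum>n<N. summand n t) \<partial>lborel) \<longlonglongrightarrow> (\<integral>t. ?lim t \<partial>lborel)"
    by (rule integral_dominated_convergence[OF dominated])
  have "(\<integral>t. (\<Sum>n<N. summand n t) \<partial>lborel) = (\<Sum>n<N. val n)" for N
    using has_bochner_integral_sum[of "{..<N}" lborel summand val, OF summand_integral]
    by (rule has_bochner_integral_integral_eq)
  then have sums1: "val sums (\<integral>t. ?lim t \<partial>lborel)"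
    using tends by (simp add: sums_def)
  \<comment> \<open>The Gamma recurrence turns the integrated exponential series into a binomial series.\<close>
  have val_eq: "val n = of_real (Gamma r / x powr r) *
      ((- of_real r gchoose n) * (h / of_real x) ^ n)" for n
  proof -
    have "r \<notin> \<int>\<^sub>\<le>\<^sub>0" using r by (auto elim!: nonpos_Ints_cases)
    then have "Gamma (r + real n) = pochhammer r n * Gamma r"
      using r by (simp add: pochhammer_Gamma Gamma_eq_zero_iff)
    then show ?thesis
      using x by (simp add: val_def gbinomial_pochhammer powr_add powr_realpow power_divide
          power_minus[of h] pochhammer_of_real mult_ac)
  qed
  have "norm (h / of_real x) < 1" using zx x by (simp add: norm_divide h_def)
  then have "val sums (of_real (Gamma r / x powr r) * (1 + h / of_real x) powr (- of_real r))"
    unfolding val_eq by (intro sums_mult gen_binomial_complex)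
  also have "of_real (Gamma r / x powr r) * (1 + h / of_real x) powr (- of_real r) =
      of_real (Gamma r) / z powr of_real r"
  proof -
    \<comment> \<open>A positive real factor may be pulled out of a principal power.\<close>
    have "z powr of_real r = (of_real x * (1 + h / of_real x)) powr of_real r"
      using x by (simp add: h_def field_simps)
    also have "\<dots> = of_real x powr of_real r * (1 + h / of_real x) powr of_real r"
      using x by (intro powr_times_real_left) auto
    also have "of_real x powr of_real r = complex_of_real (x powr r)"
      using x by (simp add: powr_of_real)
    finally show ?thesis by (simp add: powr_minus field_simps)
  qed
  finally show ?thesis
    using sums1 conv unfolding has_laplace_def has_bochner_integral_iff
    by (blast intro: sums_unique2)
qed

section \<open>Separated sums\<close>

text \<open>
  Fubini for sums of products. Separation is asked for on the open quadrant only, since powers of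
  the variables combine as expected just for positive arguments.
\<close>
lemma laplace2_sum_of_products:
  fixes f :: "real \<Rightarrow> real \<Rightarrow> complex"
  assumes fin: "finite I"
    and g: "\<And>i. i \<in> I \<Longrightarrow> has_laplace (g i) a (G i)"
    and h: "\<And>i. i \<in> I \<Longrightarrow> has_laplace (h i) b (H i)"
    and f: "\<And>t w. t > 0 \<Longrightarrow> w > 0 \<Longrightarrow> f t w = (\<Sum>i\<in>I. g i t * h i w)"
  shows "laplace2_converges f a b" and "laplace2 f a b = (\<Sum>i\<in>I. G i * H i)"
proof -
  define g' where "g' i t = indicator {0<..} t *\<^sub>R (exp (- (a * of_real t)) * g i t)" for i t
  define h' where "h' i w = indicator {0<..} w *\<^sub>R (exp (- (b * of_real w)) * h i w)" for i w
  have g': "has_bochner_integral lborel (g' i) (G i)" if "i \<in> I" for i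
    using g[OF that] unfolding has_laplace_def g'_def .
  have h': "has_bochner_integral lborel (h' i) (H i)" if "i \<in> I" for i
    using h[OF that] unfolding has_laplace_def h'_def .
  \<comment> \<open>With the indicators absorbed into the factors, the separation holds on the whole plane.\<close>
  have kernel: "indicator {0<..} w *\<^sub>R (indicator {0<..} t *\<^sub>R laplace2_kernel f a b t w) =
      (\<Sum>i\<in>I. g' i t * h' i w)" for t w
    by (auto simp: indicator_def laplace2_kernel_def f g'_def h'_def sum_distrib_left
        exp_add exp_diff exp_minus divide_inverse mult_ac intro!: sum.cong)
  have prod: "integrable (lborel \<Otimes>\<^sub>M lborel) (\<lambda>(t, w). g' i t * h' i w)" if "i \<in> I" for i
  proof (rule lborel_pair.Fubini_integrable)
    have [measurable]: "g' i \<in> borel_measurable borel" "h' i \<in> borel_measurable borel"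
      using g'[OF that] h'[OF that] by (auto dest: borel_measurable_has_bochner_integral)
    show "(\<lambda>(t, w). g' i t * h' i w) \<in> borel_measurable (lborel \<Otimes>\<^sub>M lborel)"
      by measurable
  qed (use g'[OF that] h'[OF that] in \<open>auto simp: norm_mult has_bochner_integral_iff\<close>)
  have "integrable (lborel \<Otimes>\<^sub>M lborel) (\<lambda>x. \<Sum>i\<in>I. case x of (t, w) \<Rightarrow> g' i t * h' i w)"
    using prod by (rule Bochner_Integration.integrable_sum)
  moreover have "(\<lambda>x. \<Sum>i\<in>I. case x of (t, w) \<Rightarrow> g' i t * h' i w) =
      (\<lambda>x. indicator ({0<..} \<times> {0<..}) x *\<^sub>R (case x of (t, w) \<Rightarrow> laplace2_kernel f a b t w))"
    by (rule ext) (auto simp: kernel[symmetric] indicator_times split: prod.split)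
  ultimately show "laplace2_converges f a b"
    by (simp add: laplace2_converges_def set_integrable_def lborel_prod)
  have "laplace2 f a b = (\<integral>w. (\<integral>t. (\<Sum>i\<in>I. g' i t * h' i w) \<partial>lborel) \<partial>lborel)"
    by (simp only: laplace2_def set_lebesgue_integral_def integral_scaleR_right flip: kernel)
  also have "\<dots> = (\<integral>w. (\<Sum>i\<in>I. G i * h' i w) \<partial>lborel)"
    by (intro Bochner_Integration.integral_cong refl has_bochner_integral_integral_eq
        has_bochner_integral_sum has_bochner_integral_mult_left g')
  also have "\<dots> = (\<Sum>i\<in>I. G i * H i)"
    by (intro has_bochner_integral_integral_eq has_bochner_integral_sum
        has_bochner_integral_mult_right h')
  finally show "laplace2 f a b = (\<Sum>i\<in>I. G i * H i)" .
qed

section \<open>The trinomial expansion\<close>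

text \<open>
  Up to sign, the quotient is the multinomial coefficient \<open>s! / (k! m! (s - k - m)!)\<close>. Splitting it
  into two binomial coefficients lets the double sum be evaluated by two uses of the binomial
  theorem, the inner one over \<open>m\<close>.
\<close>
lemma pochhammer_trinomial:
  assumes "k + m \<le> s"
  shows "pochhammer (- real s) (k + m) / (fact k * fact m) =
    (- 1) ^ (k + m) * (real (s choose k) * real ((s - k) choose m))"
proof -
  have "real (s choose (k + m)) = (- 1) ^ (k + m) * pochhammer (- real s) (k + m) / fact (k + m)"
    by (simp add: binomial_gbinomial gbinomial_pochhammer)
  moreover have "real (s choose (k + m)) = fact s / (fact (k + m) * fact (s - k - m))"
    using assms by (simp add: binomial_fact)
  ultimately have "pochhammer (- real s) (k + m) = (- 1) ^ (k + m) * (fact s / fact (s - k - m))"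
    by (simp add: field_simps minus_one_power_iff split: if_splits)
  then show ?thesis
    using assms by (simp add: binomial_fact)
qed

lemma trinomial_pochhammer_sum:
  fixes A X :: complex
  shows "(\<Sum>k=0..s. \<Sum>m=0..s - k.
      of_real (pochhammer (- real s) (k + m) / (fact k * fact m)) * A ^ (s - k) * X ^ m) =
    (A * (1 - X) - 1) ^ s"
proof -
  have "(A * (1 - X) - 1) ^ s = (- 1 + A * (- X + 1)) ^ s"
    by (simp add: algebra_simps)
  also have "\<dots> = (\<Sum>k=0..s. of_nat (s choose k) * (- 1) ^ k * (A ^ (s - k) * (- X + 1) ^ (s - k)))"
    unfolding binomial_ring power_mult_distrib by (simp add: atMost_atLeast0)
  also have "\<dots> = (\<Sum>k=0..s. \<Sum>m=0..s - k. of_nat (s choose k) * (- 1) ^ k * (A ^ (s - k) *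
      (of_nat ((s - k) choose m) * (- X) ^ m)))"
    unfolding binomial_ring[of "- X" 1] by (simp add: sum_distrib_left atMost_atLeast0)
  also have "\<dots> = (\<Sum>k=0..s. \<Sum>m=0..s - k.
      of_real (pochhammer (- real s) (k + m) / (fact k * fact m)) * A ^ (s - k) * X ^ m)"
    by (intro sum.cong refl)
       (simp add: pochhammer_trinomial power_add power_minus[of X] mult_ac del: of_real_divide)
  finally show ?thesis by simp
qed

section \<open>The transform of the N-Konhauser polynomials\<close>

theorem theorem32:
  fixes \<upsilon> s :: nat and p q y1 y2 :: real and a b :: complex
    and f :: "real \<Rightarrow> real \<Rightarrow> complex"
  defines "f \<equiv> \<lambda>t w. complex_of_real
    (t powr (p - real s - 1) * w powr q * N_Konhauser s \<upsilon> p q (1 / (y1 * t)) (y2 * w))"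
  assumes "\<upsilon> \<ge> 1" and "q > -1" and "real s < (p - 1) / 2"
    and "y1 \<noteq> 0" and "Re a > 0" and "Re b > 0"
  shows "laplace2_converges f a b \<and>
    laplace2 f a b =
      complex_of_real (Gamma (p - real s)) /
        (a powr complex_of_real (p - real s) * b powr complex_of_real (q + 1)) *
      (a / complex_of_real y1 * (1 - complex_of_real y2 ^ \<upsilon> / b ^ \<upsilon>) - 1) ^ s"
proof -
  define I where "I = (SIGMA k:{0..s}. {0..s - k})"
  \<comment> \<open>The parameters for which the factors of a summand are \<open>t powr (\<rho> k - 1)\<close> and
     \<open>w powr (\<sigma> m - 1)\<close>; they are also the Gamma arguments in the polynomial.\<close>
  define \<rho> where "\<rho> k = p - 2 * real s + real k" for k :: nat
  define \<sigma> where "\<sigma> m = q + 1 + real (\<upsilon> * m)" for m :: nat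
  define C where "C k m = pochhammer (- real s) (k + m) / (fact k * fact m)" for k m :: nat
  define g :: "nat \<times> nat \<Rightarrow> real \<Rightarrow> complex" where
    "g = (\<lambda>(k, m) t. of_real (Gamma (p - real s) * C k m / (y1 ^ (s - k) * Gamma (\<rho> k))) *
      of_real (t powr (\<rho> k - 1)))"
  define h :: "nat \<times> nat \<Rightarrow> real \<Rightarrow> complex" where
    "h = (\<lambda>(k, m) w. of_real (y2 ^ (\<upsilon> * m) / Gamma (\<sigma> m)) * of_real (w powr (\<sigma> m - 1)))"
  define G where "G = (\<lambda>(k, m). of_real (Gamma (p - real s) * C k m / (y1 ^ (s - k) * Gamma (\<rho> k))) *
      (of_real (Gamma (\<rho> k)) / a powr of_real (\<rho> k)))"
  define H where "H = (\<lambda>(k::nat, m). of_real (y2 ^ (\<upsilon> * m) / Gamma (\<sigma> m)) *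
      (of_real (Gamma (\<sigma> m)) / b powr of_real (\<sigma> m)))"
  have \<rho>: "\<rho> k > 0" and \<sigma>: "\<sigma> m > 0" for k m
    using assms by (auto simp: \<rho>_def \<sigma>_def intro: add_pos_nonneg)
  have ab: "a \<noteq> 0" "b \<noteq> 0" using assms by auto
  have term_split: "of_real (t powr (p - real s - 1) * w powr q *
      (Gamma (p - real s) * (pochhammer (- real s) (k + m) * (1 / (y1 * t)) ^ (s - k) *
        (y2 * w) ^ (\<upsilon> * m) / (Gamma (\<rho> k) * Gamma (\<sigma> m) * fact k * fact m)))) =
      g (k, m) t * h (k, m) w"
    if "t > 0" "w > 0" "k \<le> s" for t w :: real and k m
  proof -
    have "\<rho> k - 1 = (p - real s - 1) - real (s - k)"
      using that by (simp add: \<rho>_def of_nat_diff)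
    then have t: "t powr (\<rho> k - 1) = t powr (p - real s - 1) / t ^ (s - k)"
      using that by (simp only: powr_diff[of t "p - real s - 1"] powr_realpow)
    have w: "w powr (\<sigma> m - 1) = w powr q * w ^ (\<upsilon> * m)"
      using that by (simp add: \<sigma>_def powr_add powr_realpow flip: of_nat_mult)
    show ?thesis
      unfolding g_def h_def prod.case t w of_real_mult[symmetric] C_def
      by (rule arg_cong[where f = of_real]) (simp add: power_mult_distrib power_one_over mult_ac)
  qed
  have f_eq: "f t w = (\<Sum>i\<in>I. g i t * h i w)" if tw: "t > 0" "w > 0" for t w
  proof -
    have "(\<Sum>i\<in>I. g i t * h i w) = (\<Sum>k=0..s. \<Sum>m=0..s - k. g (k, m) t * h (k, m) w)"
      unfolding I_def by (simp add: sum.Sigma split_beta)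
    also have "\<dots> = f t w"
      unfolding f_def N_Konhauser_def sum_distrib_left of_real_sum
      by (intro sum.cong refl, subst term_split[symmetric]) (use tw in \<open>auto simp: \<rho>_def \<sigma>_def\<close>)
    finally show ?thesis ..
  qed
  note L = laplace2_sum_of_products[of I g a G h b H f]
  have gG: "has_laplace (g i) a (G i)" for i
    unfolding g_def G_def split_beta
    by (intro has_laplace_mult_left has_laplace_powr \<rho> assms)
  have hH: "has_laplace (h i) b (H i)" for i
    unfolding h_def H_def split_beta
    by (intro has_laplace_mult_left has_laplace_powr \<sigma> assms)
  have fin: "finite I" by (simp add: I_def)
  define K where "K = complex_of_real (Gamma (p - real s)) /
    (a powr complex_of_real (p - real s) * b powr complex_of_real (q + 1))"
  have GH: "G (k, m) * H (k, m) = K * (of_real (C k m) *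
      (a / of_real y1) ^ (s - k) * (of_real y2 ^ \<upsilon> / b ^ \<upsilon>) ^ m)" if "k \<le> s" for k m
  proof -
    have "complex_of_real (\<rho> k) = of_real (p - real s) - of_nat (s - k)"
      using that by (simp add: \<rho>_def of_nat_diff)
    then have pa: "a powr of_real (\<rho> k) = a powr of_real (p - real s) / a ^ (s - k)"
      using ab by (simp only: powr_diff powr_nat') simp
    have "complex_of_real (\<sigma> m) = of_real (q + 1) + of_nat (\<upsilon> * m)"
      by (simp add: \<sigma>_def)
    then have pb: "b powr of_real (\<sigma> m) = b powr of_real (q + 1) * b ^ (\<upsilon> * m)"
      using ab by (simp only: powr_add powr_nat' simp_thms)
    have "Gamma (\<rho> k) \<noteq> 0" "Gamma (\<sigma> m) \<noteq> 0"
      using Gamma_real_pos[OF \<rho>[of k]] Gamma_real_pos[OF \<sigma>[of m]] by auto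
    then show ?thesis
      using ab \<open>y1 \<noteq> 0\<close>
      by (simp add: G_def H_def K_def pa pb power_divide mult_ac flip: power_mult)
  qed
  have "(\<Sum>i\<in>I. G i * H i) = (\<Sum>k=0..s. \<Sum>m=0..s - k. G (k, m) * H (k, m))"
    unfolding I_def by (simp add: sum.Sigma split_beta)
  also have "\<dots> = K * (\<Sum>k=0..s. \<Sum>m=0..s - k. of_real (C k m) *
      (a / of_real y1) ^ (s - k) * (of_real y2 ^ \<upsilon> / b ^ \<upsilon>) ^ m)"
    unfolding sum_distrib_left by (intro sum.cong refl GH) auto
  also have "\<dots> = K * (a / of_real y1 * (1 - of_real y2 ^ \<upsilon> / b ^ \<upsilon>) - 1) ^ s"
    unfolding C_def by (subst trinomial_pochhammer_sum) (rule refl)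
  finally show ?thesis
    using L[OF fin gG hH f_eq] by (simp add: K_def)
qed

end
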